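(* Let $X$ be a smooth vector field on a smooth manifold $M$. Then $X$ is hamiltonizable by a Poisson structure of the form $Y\wedge X$ on $M$ (i.e. there exist $Y\in\Gamma(TM)$ and $h\in C^\infty(M)$ such that $\pi=Y\wedge X$ is Poisson and $\pi^\sharp\mathrm{d}h=X$) if and only if $X$ admits an invariant normal class that is normalized with respect to a first integral of $X$ that is regular on $\operatorname{supp}(X)$. In this case, given a first integral $h$ of $X$ regular on $\operatorname{supp}(X)$, a Poisson structure $\pi$ on $M$ satisfying $\pi^\sharp\mathrm{d}h=X$ is given by $$\pi:=\begin{cases}Y_0\wedge X&\text{on }\operatorname{supp}(X),\\0&\text{elsewhere},\end{cases}$$ where $Y_0$ is any vector field defined on a neighborhood of $\operatorname{supp}(X)$ satisfying $\mathrm{d}h|_{\operatorname{supp}(X)}(Y_0)=1$ and $[X,Y_0]\wedge X=0$.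
   Context: A Poisson structure is a bivector field $\pi$ with $[\pi,\pi]=0$ (Schouten–Nijenhuis bracket). $\pi^\sharp\alpha=\mathbf{i}_\alpha\pi=\pi(\alpha,\cdot)$, so $(Y\wedge X)^\sharp\alpha=\alpha(Y)X-\alpha(X)Y$. A first integral of $X$ is $h\in C^\infty(M)$ with $\mathrm{d}h(X)=0$; it is regular on a set if $\mathrm{d}h$ is nonzero at each point of the set. $\operatorname{supp}(X)$ is the closure of $\{X\ne0\}$. A normal class relative to $X$ is an equivalence class $[Y]$ of vector fields on $M$ under the relation $Y_1\sim_X Y_2$ iff $(Y_2-Y_1)\wedge X=0$. A normal class $[Y]$ is invariant if $[X,Y]\wedge X\wedge Y=0$; it is normalized with respect to a first integral $h$ of $X$ if $\mathrm{d}h(Y)X=X$. (Both properties are independent of the representative.) *)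

theory Defs
  imports "HOL-Analysis.Analysis"
begin

section \<open>Smooth maps and smooth manifolds\<close>

text \<open>Iterated directional derivatives; the predicate is only used for open \<open>S\<close> in a
  finite-dimensional domain, where it is the usual notion of a \<open>C\<^sup>k\<close> map.\<close>

primrec Ck_on :: "nat \<Rightarrow> 'a::real_normed_vector set \<Rightarrow> ('a \<Rightarrow> 'b::real_normed_vector) \<Rightarrow> bool" where
  "Ck_on 0 S f \<longleftrightarrow> continuous_on S f"
| "Ck_on (Suc k) S f \<longleftrightarrow> (\<forall>x\<in>S. f differentiable (at x)) \<and>
     (\<forall>v. Ck_on k S (\<lambda>x. frechet_derivative f (at x) v))"

definition smooth_on :: "'a::real_normed_vector set \<Rightarrow> ('a \<Rightarrow> 'b::real_normed_vector) \<Rightarrow> bool" where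
  "smooth_on S f \<longleftrightarrow> (\<forall>k. Ck_on k S f)"

text \<open>A chart is a pair of its domain and its coordinate map, whose values outside the domain
  are irrelevant.\<close>

type_synonym ('m, 'e) chart = "'m set \<times> ('m \<Rightarrow> 'e)"

definition is_chart :: "('m::topological_space, 'e::topological_space) chart \<Rightarrow> bool" where
  "is_chart c \<longleftrightarrow> (case c of (U, \<phi>) \<Rightarrow>
     open U \<and> open (\<phi> ` U) \<and> homeomorphism U (\<phi> ` U) \<phi> (inv_into U \<phi>))"

text \<open>The underlying set of the manifold is the type \<open>'m\<close>, and \<open>A\<close> is a smooth atlas.  The model
  space is a finite-dimensional normed space rather than a type of class \<open>euclidean_space\<close>,
  because the latter excludes dimension 0.\<close>

definition smooth_manifold ::
    "('m::{t2_space,second_countable_topology}, 'e::real_normed_vector) chart set \<Rightarrow> bool" where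
  "smooth_manifold A \<longleftrightarrow>
     (\<exists>B::'e set. finite B \<and> span B = UNIV) \<and>
     (\<forall>c\<in>A. is_chart c) \<and>
     (\<Union>(U, \<phi>)\<in>A. U) = UNIV \<and>
     (\<forall>(U, \<phi>)\<in>A. \<forall>(V, \<psi>)\<in>A. smooth_on (\<phi> ` (U \<inter> V)) (\<psi> \<circ> inv_into U \<phi>))"

text \<open>\<open>C_inf A V\<close> is \<open>C\<^sup>\<infinity>(V)\<close> for open \<open>V\<close>; its elements are total functions whose values outside
  \<open>V\<close> are irrelevant.\<close>

definition C_inf ::
    "('m::topological_space, 'e::real_normed_vector) chart set \<Rightarrow> 'm set \<Rightarrow> ('m \<Rightarrow> real) set" where
  "C_inf A V = {f. \<forall>(U, \<phi>)\<in>A. smooth_on (\<phi> ` (U \<inter> V)) (f \<circ> inv_into U \<phi>)}"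

definition smooth_near ::
    "('m::topological_space, 'e::real_normed_vector) chart set \<Rightarrow> 'm \<Rightarrow> ('m \<Rightarrow> real) \<Rightarrow> bool" where
  "smooth_near A p f \<longleftrightarrow> (\<exists>V. open V \<and> p \<in> V \<and> f \<in> C_inf A V)"


section \<open>Tangent vectors and vector fields\<close>

text \<open>A tangent vector at \<open>p\<close> is a derivation on germs at \<open>p\<close> of smooth functions.  It is extended
  by 0 to functions that are not smooth near \<open>p\<close>, so that equality of tangent vectors is equality
  of HOL functions.  The value \<open>v f\<close> is the pairing of the covector \<open>d\<^sub>p f\<close> with \<open>v\<close>.\<close>

type_synonym 'm tvec = "('m \<Rightarrow> real) \<Rightarrow> real"
type_synonym 'm vfield = "'m \<Rightarrow> 'm tvec"

definition tangent_space ::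
    "('m::topological_space, 'e::real_normed_vector) chart set \<Rightarrow> 'm \<Rightarrow> 'm tvec set" where
  "tangent_space A p = {v.
     (\<forall>f. \<not> smooth_near A p f \<longrightarrow> v f = 0) \<and>
     (\<forall>f g. smooth_near A p f \<longrightarrow> (\<forall>\<^sub>F q in nhds p. f q = g q) \<longrightarrow> v f = v g) \<and>
     (\<forall>f g. smooth_near A p f \<longrightarrow> smooth_near A p g \<longrightarrow> v (\<lambda>q. f q + g q) = v f + v g) \<and>
     (\<forall>a f. smooth_near A p f \<longrightarrow> v (\<lambda>q. a * f q) = a * v f) \<and>
     (\<forall>f g. smooth_near A p f \<longrightarrow> smooth_near A p g \<longrightarrow>
        v (\<lambda>q. f q * g q) = f p * v g + v f * g p)}"

text \<open>Smooth vector fields on the open set \<open>U\<close>.\<close>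

definition vector_fields ::
    "('m::topological_space, 'e::real_normed_vector) chart set \<Rightarrow> 'm set \<Rightarrow> 'm vfield set" where
  "vector_fields A U = {X.
     (\<forall>p\<in>U. X p \<in> tangent_space A p) \<and>
     (\<forall>V f. open V \<longrightarrow> V \<subseteq> U \<longrightarrow> f \<in> C_inf A V \<longrightarrow> (\<lambda>p. X p f) \<in> C_inf A V)}"

definition lie_bracket ::
    "('m::topological_space, 'e::real_normed_vector) chart set \<Rightarrow> 'm vfield \<Rightarrow> 'm vfield \<Rightarrow> 'm vfield"
  where
  "lie_bracket A X Y p f =
     (if smooth_near A p f then X p (\<lambda>q. Y q f) - Y p (\<lambda>q. X q f) else 0)"

definition supp :: "'m::topological_space vfield \<Rightarrow> 'm set" where
  "supp X = closure {p. X p \<noteq> (\<lambda>f. 0)}"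


section \<open>Multivectors and Poisson structures\<close>

text \<open>A bivector \<open>b\<close> at \<open>p\<close> is evaluated on the covectors \<open>d\<^sub>p f\<close> and \<open>d\<^sub>p g\<close> through \<open>b f g\<close>;
  likewise for trivectors.  The normalization of the wedge product is the determinant one, so that
  \<open>(v \<and> w)(\<alpha>, \<beta>) = \<alpha>(v) \<beta>(w) - \<alpha>(w) \<beta>(v)\<close>.\<close>

type_synonym 'm bivec = "('m \<Rightarrow> real) \<Rightarrow> ('m \<Rightarrow> real) \<Rightarrow> real"
type_synonym 'm trivec = "('m \<Rightarrow> real) \<Rightarrow> ('m \<Rightarrow> real) \<Rightarrow> ('m \<Rightarrow> real) \<Rightarrow> real"

definition wedge2 :: "'m tvec \<Rightarrow> 'm tvec \<Rightarrow> 'm bivec" where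
  "wedge2 v w f g = v f * w g - w f * v g"

definition wedge3 :: "'m tvec \<Rightarrow> 'm tvec \<Rightarrow> 'm tvec \<Rightarrow> 'm trivec" where
  "wedge3 u v w f g k =
     u f * (v g * w k - w g * v k) + u g * (v k * w f - w k * v f) + u k * (v f * w g - w f * v g)"

text \<open>The second exterior power of the tangent space consists of the finite sums of decomposable
  bivectors.\<close>

definition bivectors ::
    "('m::topological_space, 'e::real_normed_vector) chart set \<Rightarrow> 'm \<Rightarrow> 'm bivec set" where
  "bivectors A p = {(\<lambda>f g. \<Sum>i<n. wedge2 (v i) (w i) f g) | (n::nat) v w.
     \<forall>i<n. v i \<in> tangent_space A p \<and> w i \<in> tangent_space A p}"

definition bivector_fields ::
    "('m::topological_space, 'e::real_normed_vector) chart set \<Rightarrow> ('m \<Rightarrow> 'm bivec) set" where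
  "bivector_fields A = {P.
     (\<forall>p. P p \<in> bivectors A p) \<and>
     (\<forall>V f g. open V \<longrightarrow> f \<in> C_inf A V \<longrightarrow> g \<in> C_inf A V \<longrightarrow> (\<lambda>p. P p f g) \<in> C_inf A V)}"

text \<open>The Schouten--Nijenhuis bracket of two bivector fields, evaluated on exact 1-forms:
  \<open>[P,Q](df,dg,dk)\<close> is the cyclic sum of \<open>P(df, d(Q(dg,dk))) + Q(df, d(P(dg,dk)))\<close>.  The terms
  with second derivatives of \<open>f\<close>, \<open>g\<close>, \<open>k\<close> cancel, and in coordinates this is the cyclic sum over
  \<open>i, j, k\<close> of \<open>P\<^sup>i\<^sup>l \<partial>\<^sub>l Q\<^sup>j\<^sup>k + Q\<^sup>i\<^sup>l \<partial>\<^sub>l P\<^sup>j\<^sup>k\<close> (summed over \<open>l\<close>).  With this sign,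
  \<open>[Y \<and> X, Y \<and> X] = 2 [X,Y] \<and> X \<and> Y\<close>.\<close>

definition schouten ::
    "('m::topological_space, 'e::real_normed_vector) chart set \<Rightarrow>
      ('m \<Rightarrow> 'm bivec) \<Rightarrow> ('m \<Rightarrow> 'm bivec) \<Rightarrow> 'm \<Rightarrow> 'm trivec" where
  "schouten A P Q p f g k =
     (if smooth_near A p f \<and> smooth_near A p g \<and> smooth_near A p k then
        P p f (\<lambda>q. Q q g k) + P p g (\<lambda>q. Q q k f) + P p k (\<lambda>q. Q q f g) +
        Q p f (\<lambda>q. P q g k) + Q p g (\<lambda>q. P q k f) + Q p k (\<lambda>q. P q f g)
      else 0)"

definition poisson ::
    "('m::topological_space, 'e::real_normed_vector) chart set \<Rightarrow> ('m \<Rightarrow> 'm bivec) \<Rightarrow> bool" where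
  "poisson A P \<longleftrightarrow> P \<in> bivector_fields A \<and> (\<forall>p. schouten A P P p = (\<lambda>f g k. 0))"

text \<open>The vector field \<open>P\<^sup>\<sharp> dh = P(dh, \<cdot>)\<close>.\<close>

definition sharp_d :: "('m \<Rightarrow> 'm bivec) \<Rightarrow> ('m \<Rightarrow> real) \<Rightarrow> 'm vfield" where
  "sharp_d P h p = (\<lambda>f. P p h f)"

text \<open>Hamiltonizability by a Poisson structure of the form \<open>Y \<and> X\<close>.\<close>

definition wedge_hamiltonizable ::
    "('m::topological_space, 'e::real_normed_vector) chart set \<Rightarrow> 'm vfield \<Rightarrow> bool" where
  "wedge_hamiltonizable A X \<longleftrightarrow>
     (\<exists>Y\<in>vector_fields A UNIV. \<exists>h\<in>C_inf A UNIV.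
        poisson A (\<lambda>p. wedge2 (Y p) (X p)) \<and> sharp_d (\<lambda>p. wedge2 (Y p) (X p)) h = X)"


section \<open>First integrals and normal classes\<close>

definition first_integral ::
    "('m::topological_space, 'e::real_normed_vector) chart set \<Rightarrow> 'm vfield \<Rightarrow> ('m \<Rightarrow> real) \<Rightarrow> bool"
  where
  "first_integral A X h \<longleftrightarrow> h \<in> C_inf A UNIV \<and> (\<forall>p. X p h = 0)"

text \<open>\<open>d\<^sub>p h\<close> is nonzero as a functional on the tangent space, for each \<open>p \<in> S\<close>.\<close>

definition regular_on ::
    "('m::topological_space, 'e::real_normed_vector) chart set \<Rightarrow> ('m \<Rightarrow> real) \<Rightarrow> 'm set \<Rightarrow> bool" where
  "regular_on A h S \<longleftrightarrow> (\<forall>p\<in>S. \<exists>v\<in>tangent_space A p. v h \<noteq> 0)"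

definition normal_rel ::
    "('m::topological_space, 'e::real_normed_vector) chart set \<Rightarrow> 'm vfield \<Rightarrow> 'm vfield rel" where
  "normal_rel A X = {(Y1, Y2). Y1 \<in> vector_fields A UNIV \<and> Y2 \<in> vector_fields A UNIV \<and>
     (\<forall>p. wedge2 (\<lambda>f. Y2 p f - Y1 p f) (X p) = (\<lambda>f g. 0))}"

definition normal_classes ::
    "('m::topological_space, 'e::real_normed_vector) chart set \<Rightarrow> 'm vfield \<Rightarrow> 'm vfield set set" where
  "normal_classes A X = vector_fields A UNIV // normal_rel A X"

text \<open>The following two properties hold for all representatives of a class as soon as they hold
  for one.\<close>

definition invariant_class ::
    "('m::topological_space, 'e::real_normed_vector) chart set \<Rightarrow> 'm vfield \<Rightarrow> 'm vfield set \<Rightarrow> bool"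
  where
  "invariant_class A X C \<longleftrightarrow>
     (\<forall>Y\<in>C. \<forall>p. wedge3 (lie_bracket A X Y p) (X p) (Y p) = (\<lambda>f g k. 0))"

definition normalized_class :: "'m vfield \<Rightarrow> ('m \<Rightarrow> real) \<Rightarrow> 'm vfield set \<Rightarrow> bool" where
  "normalized_class X h C \<longleftrightarrow> (\<forall>Y\<in>C. \<forall>p. (\<lambda>f. Y p h * X p f) = X p)"

text \<open>\<open>Y0\<close> is a vector field on the open neighborhood \<open>U\<close> of \<open>supp X\<close> with \<open>dh(Y0) = 1\<close> on
  \<open>supp X\<close> and \<open>[X,Y0] \<and> X = 0\<close> on \<open>U\<close>.\<close>

definition transversal_near_supp ::
    "('m::topological_space, 'e::real_normed_vector) chart set \<Rightarrow> 'm vfield \<Rightarrow> ('m \<Rightarrow> real) \<Rightarrow>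
      'm set \<Rightarrow> 'm vfield \<Rightarrow> bool" where
  "transversal_near_supp A X h U Y0 \<longleftrightarrow>
     open U \<and> supp X \<subseteq> U \<and> Y0 \<in> vector_fields A U \<and>
     (\<forall>p\<in>supp X. Y0 p h = 1) \<and>
     (\<forall>p\<in>U. wedge2 (lie_bracket A X Y0 p) (X p) = (\<lambda>f g. 0))"

definition glued_bivector :: "'m::topological_space vfield \<Rightarrow> 'm vfield \<Rightarrow> 'm \<Rightarrow> 'm bivec" where
  "glued_bivector X Y0 p = (if p \<in> supp X then wedge2 (Y0 p) (X p) else (\<lambda>f g. 0))"

end

theory Submission
  imports Defs
begin

text \<open>The Schouten bracket of \<open>Y \<and> X\<close> with itself is \<open>2 [X,Y] \<and> X \<and> Y\<close>, so \<open>Y \<and> X\<close> is Poisson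
  exactly when the class of \<open>Y\<close> is invariant, and \<open>(Y \<and> X)\<^sup>\<sharp> dh = X\<close> says \<open>dh(X) = 0\<close> and
  \<open>dh(Y) X = X\<close>.  The latter makes \<open>dh(Y)\<close> equal to 1 where \<open>X\<close> is nonzero, hence on \<open>supp X\<close> by
  continuity.  Finally \<open>dh(Y) X = X\<close> forces \<open>dh([X,Y]) = 0\<close> where \<open>X\<close> is nonzero, so
  contracting \<open>[X,Y] \<and> X \<and> Y = 0\<close> with \<open>dh\<close> leaves \<open>[X,Y] \<and> X = 0\<close>: a representative of the class
  can itself serve as \<open>Y\<^sub>0\<close>, on the neighborhood \<open>M\<close>.\<close>

section \<open>Calculus of smooth functions\<close>

lemma Ck_on_subset: "Ck_on k S f \<Longrightarrow> T \<subseteq> S \<Longrightarrow> Ck_on k T f"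
  by (induction k arbitrary: f) (auto intro: continuous_on_subset)

lemma Ck_on_Suc_imp: "Ck_on (Suc k) S f \<Longrightarrow> Ck_on k S f"
proof (induction k arbitrary: f)
  case 0
  then show ?case
    by (simp add: continuous_at_imp_continuous_on differentiable_imp_continuous_within)
next
  case (Suc k)
  from Suc.prems have "\<forall>x\<in>S. f differentiable (at x)"
      "\<And>v. Ck_on (Suc k) S (\<lambda>x. frechet_derivative f (at x) v)"
    unfolding Ck_on.simps(2)[of "Suc k"] by blast+
  with Suc.IH show ?case
    unfolding Ck_on.simps(2)[of k] by blast
qed

text \<open>Derivatives depend only on germs: the derivative of a local model \<open>g\<close> is a
  local model for that of \<open>f\<close>, which feeds the induction. Later this lets functions be
  glued from smooth pieces.\<close>

lemma Ck_on_locally: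
  assumes "\<And>x. x \<in> S \<Longrightarrow> \<exists>T g. open T \<and> x \<in> T \<and> Ck_on k T g \<and> (\<forall>y\<in>T. f y = g y)"
  shows "Ck_on k S f"
  using assms
proof (induction k arbitrary: f)
  case 0
  have "isCont f x" if x: "x \<in> S" for x
  proof -
    obtain T g where T: "open T" "x \<in> T" "continuous_on T g" "\<forall>y\<in>T. f y = g y"
      using 0[OF x] by auto
    then have "continuous_on T f"
      by (simp cong: continuous_on_cong)
    then show ?thesis
      using T continuous_on_eq_continuous_at by blast
  qed
  then show ?case
    by (simp add: continuous_at_imp_continuous_on)
next
  case (Suc k)
  have deriv: "(f has_derivative frechet_derivative g (at y)) (at y)"
    if "open T" "Ck_on (Suc k) T g" "\<forall>y\<in>T. f y = g y" "y \<in> T" for T g y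
  proof -
    have "(g has_derivative frechet_derivative g (at y)) (at y)"
      using that by (simp add: frechet_derivative_works)
    then show ?thesis
      by (rule has_derivative_transform_within_open[OF _ that(1,4)]) (use that in auto)
  qed
  have "f differentiable (at x)" if "x \<in> S" for x
    using Suc.prems[OF that] deriv unfolding differentiable_def by blast
  moreover have "Ck_on k S (\<lambda>x. frechet_derivative f (at x) v)" for v
  proof (rule Suc.IH)
    fix x assume "x \<in> S"
    then obtain T g where T: "open T" "x \<in> T" "Ck_on (Suc k) T g" "\<forall>y\<in>T. f y = g y"
      using Suc.prems by blast
    have "frechet_derivative f (at y) v = frechet_derivative g (at y) v" if "y \<in> T" for y
      using frechet_derivative_at[OF deriv[OF T(1,3,4) that]] by simp
    with T show "\<exists>T g. open T \<and> x \<in> T \<and> Ck_on k T g \<and>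
        (\<forall>y\<in>T. frechet_derivative f (at y) v = g y)"
      by (intro exI[of _ T] exI[of _ "\<lambda>y. frechet_derivative g (at y) v"]) auto
  qed
  ultimately show ?case by simp
qed

text \<open>Openness matters: \<open>frechet_derivative f (at x)\<close> sees values of
  \<open>f\<close> all around \<open>x\<close>, so \<open>S\<close> itself must be a neighborhood of
  \<open>x\<close>.\<close>

lemma Ck_on_cong:
  assumes "open S" "Ck_on k S g" "\<And>x. x \<in> S \<Longrightarrow> f x = g x"
  shows "Ck_on k S f"
  by (rule Ck_on_locally) (use assms in blast)

lemma Ck_on_const: "Ck_on k S (\<lambda>x. c)"
  by (induction k arbitrary: c) auto

lemma Ck_on_add:
  assumes "open S" "Ck_on k S f" "Ck_on k S g"
  shows "Ck_on k S (\<lambda>x. f x + g x)"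
  using assms(2,3)
proof (induction k arbitrary: f g)
  case (Suc k)
  have deriv: "((\<lambda>x. f x + g x) has_derivative
      (\<lambda>v. frechet_derivative f (at x) v + frechet_derivative g (at x) v)) (at x)"
    if "x \<in> S" for x
    using Suc.prems that by (intro has_derivative_add) (auto simp: frechet_derivative_works)
  have "Ck_on k S (\<lambda>x. frechet_derivative (\<lambda>x. f x + g x) (at x) v)" for v
  proof (rule Ck_on_cong[OF assms(1)])
    show "Ck_on k S (\<lambda>x. frechet_derivative f (at x) v + frechet_derivative g (at x) v)"
      using Suc.prems by (intro Suc.IH) auto
  qed (simp add: frechet_derivative_at[OF deriv, symmetric])
  then show ?case
    using Suc.prems by auto
qed (simp add: continuous_on_add)

lemma Ck_on_mult:
  fixes f g :: "'a::real_normed_vector \<Rightarrow> real"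
  assumes "open S" "Ck_on k S f" "Ck_on k S g"
  shows "Ck_on k S (\<lambda>x. f x * g x)"
  using assms(2,3)
proof (induction k arbitrary: f g)
  case (Suc k)
  have deriv: "((\<lambda>x. f x * g x) has_derivative
      (\<lambda>v. f x * frechet_derivative g (at x) v + frechet_derivative f (at x) v * g x)) (at x)"
    if "x \<in> S" for x
    using Suc.prems that by (intro has_derivative_mult) (auto simp: frechet_derivative_works)
  have "Ck_on k S (\<lambda>x. frechet_derivative (\<lambda>x. f x * g x) (at x) v)" for v
  proof (rule Ck_on_cong[OF assms(1)])
    show "Ck_on k S (\<lambda>x. f x * frechet_derivative g (at x) v + frechet_derivative f (at x) v * g x)"
      \<comment> \<open>The product rule leaves \<open>f\<close> and \<open>g\<close>
        undifferentiated in one factor each, so their own smoothness has to be lowered from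
        \<open>Suc k\<close> to \<open>k\<close>.\<close>
      using Suc.prems Ck_on_Suc_imp[OF Suc.prems(1)] Ck_on_Suc_imp[OF Suc.prems(2)]
      by (intro Ck_on_add assms(1) Suc.IH) auto
  qed (simp add: frechet_derivative_at[OF deriv, symmetric])
  then show ?case
    using Suc.prems by auto
qed (simp add: continuous_on_mult)

section \<open>Charts, germs and derivations\<close>

lemma chart_image_open:
  assumes "is_chart (U, \<phi>)" "open V"
  shows "open (\<phi> ` (U \<inter> V))"
proof -
  have h: "homeomorphism U (\<phi> ` U) \<phi> (inv_into U \<phi>)" and o: "open (\<phi> ` U)"
    using assms(1) by (auto simp: is_chart_def)
  have "openin (top_of_set (\<phi> ` U)) (\<phi> ` (U \<inter> V))"
    by (rule homeomorphism_imp_open_map[OF h]) (simp add: assms(2) openin_open_Int)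
  then show ?thesis
    using o openin_open_eq by blast
qed

lemma chart_inv: "is_chart (U, \<phi>) \<Longrightarrow> q \<in> U \<Longrightarrow> inv_into U \<phi> (\<phi> q) = q"
  by (auto simp: is_chart_def homeomorphism_def)

lemma C_inf_subset: "f \<in> C_inf A V \<Longrightarrow> W \<subseteq> V \<Longrightarrow> f \<in> C_inf A W"
  unfolding C_inf_def smooth_on_def
  by (fastforce intro: Ck_on_subset)

text \<open>This makes iterated derivatives such as \<open>X p (\<lambda>q. Y q f)\<close>
  accessible to the rules for derivations. A field on \<open>U\<close> acts only on functions over
  open subsets of \<open>U\<close>, hence the restriction to \<open>U \<inter> V\<close>.\<close>

lemma smooth_near_vector_field:
  assumes "X \<in> vector_fields A U" "open U" "p \<in> U" "smooth_near A p f"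
  shows "smooth_near A p (\<lambda>q. X q f)"
proof -
  obtain V where V: "open V" "p \<in> V" "f \<in> C_inf A V"
    using assms(4) unfolding smooth_near_def by blast
  then have "f \<in> C_inf A (U \<inter> V)"
    by (auto elim: C_inf_subset)
  then have "(\<lambda>q. X q f) \<in> C_inf A (U \<inter> V)"
    using assms V unfolding vector_fields_def by (simp add: open_Int)
  with V assms show ?thesis
    unfolding smooth_near_def by blast
qed

lemma tangent_mult:
  assumes "v \<in> tangent_space A p" "smooth_near A p f" "smooth_near A p g"
  shows "v (\<lambda>q. f q * g q) = f p * v g + v f * g p"
  using assms unfolding tangent_space_def by blast

lemma tangent_scale:
  assumes "v \<in> tangent_space A p" "smooth_near A p f"
  shows "v (\<lambda>q. a * f q) = a * v f"
  using assms unfolding tangent_space_def by blast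

lemma tangent_local:
  assumes "v \<in> tangent_space A p" "smooth_near A p f" "\<forall>\<^sub>F q in nhds p. f q = g q"
  shows "v f = v g"
  using assms unfolding tangent_space_def by blast

lemma tangent_not_smooth: "v \<in> tangent_space A p \<Longrightarrow> \<not> smooth_near A p f \<Longrightarrow> v f = 0"
  unfolding tangent_space_def by blast

section \<open>Pointwise algebra of normal classes and of the glued bivector\<close>

lemma normal_class_rep:
  assumes "C \<in> normal_classes A X"
  obtains Y where "Y \<in> C" "Y \<in> vector_fields A UNIV"
proof -
  obtain Y where "Y \<in> vector_fields A UNIV" "C = normal_rel A X `` {Y}"
    using assms unfolding normal_classes_def by (auto elim: quotientE)
  then show ?thesis
    by (intro that[of Y]) (auto simp: normal_rel_def wedge2_def fun_eq_iff)
qed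

text \<open>The bivector sees only the normal class; independence of the representative will be read
  off from this.\<close>

lemma normal_rel_wedge2_eq:
  assumes "(Y, Y') \<in> normal_rel A X"
  shows "wedge2 (Y' p) (X p) = wedge2 (Y p) (X p)"
proof (intro ext)
  fix f g
  have "wedge2 (\<lambda>f. Y' p f - Y p f) (X p) f g = 0"
    using assms unfolding normal_rel_def by simp
  then show "wedge2 (Y' p) (X p) f g = wedge2 (Y p) (X p) f g"
    by (simp add: wedge2_def algebra_simps)
qed

lemma sharp_wedge2_iff:
  "sharp_d (\<lambda>p. wedge2 (Y p) (X p)) h = X \<longleftrightarrow>
    (\<forall>p. X p h = 0) \<and> (\<forall>p. (\<lambda>f. Y p h * X p f) = X p)"
proof
  assume eq: "sharp_d (\<lambda>p. wedge2 (Y p) (X p)) h = X"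
  have s: "Y p h * X p f - X p h * Y p f = X p f" for p f
    using fun_cong[OF fun_cong[OF eq, of p], of f] by (simp add: sharp_d_def wedge2_def)
  \<comment> \<open>Pairing with \<open>dh\<close> itself: at \<open>f = h\<close> the left side of
    \<open>s\<close> vanishes by antisymmetry.\<close>
  have "X p h = 0" for p
    using s[of p h] by (simp add: mult.commute)
  then show "(\<forall>p. X p h = 0) \<and> (\<forall>p. (\<lambda>f. Y p h * X p f) = X p)"
    using s by auto
qed (auto simp: sharp_d_def wedge2_def fun_eq_iff)

lemma zero_outside_supp: "p \<notin> supp X \<Longrightarrow> X p = (\<lambda>f. 0)"
  unfolding supp_def using closure_subset[of "{p. X p \<noteq> (\<lambda>f. 0)}"]
  by (metis (mono_tags, lifting) mem_Collect_eq subsetD)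

text \<open>Off \<open>supp X\<close> both sides vanish together with \<open>X q\<close>, whatever
  value \<open>Y0 q\<close> has there. So the case distinction disappears and the bracket formula
  for a wedge product becomes applicable.\<close>

lemma glued_bivector_eq:
  "glued_bivector X Y0 q = wedge2 (Y0 q) (X q)"
  using zero_outside_supp[of q X]
  by (auto simp: glued_bivector_def wedge2_def fun_eq_iff)

lemma sharp_glued_bivector:
  assumes "first_integral A X h" and "transversal_near_supp A X h U Y0"
  shows "sharp_d (glued_bivector X Y0) h = X"
proof
  fix p
  show "sharp_d (glued_bivector X Y0) h p = X p"
    using assms zero_outside_supp[of p X]
    by (cases "p \<in> supp X")
      (auto simp: sharp_d_def glued_bivector_def wedge2_def first_integral_def
        transversal_near_supp_def)
qed

section \<open>Smooth functions and derivations on the manifold\<close>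

context
  fixes A :: "('m::{t2_space,second_countable_topology}, 'e::real_normed_vector) chart set"
  assumes mfd: "smooth_manifold A"
begin

lemma charts: "(U, \<phi>) \<in> A \<Longrightarrow> is_chart (U, \<phi>)"
  using mfd by (auto simp: smooth_manifold_def)

text \<open>Chart images of open sets are open, so locality of \<open>Ck_on\<close> transfers from
  the model space to the manifold.\<close>

lemma C_inf_locally:
  assumes "\<And>p. p \<in> V \<Longrightarrow> \<exists>W g. open W \<and> p \<in> W \<and> g \<in> C_inf A W \<and> (\<forall>q\<in>W. f q = g q)"
  shows "f \<in> C_inf A V"
proof -
  have "Ck_on k (\<phi> ` (U \<inter> V)) (f \<circ> inv_into U \<phi>)" if c: "(U, \<phi>) \<in> A" for U \<phi> k
  proof (rule Ck_on_locally)
    fix x assume "x \<in> \<phi> ` (U \<inter> V)"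
    then obtain p where p: "x = \<phi> p" "p \<in> U" "p \<in> V" by blast
    then obtain W g where W: "open W" "p \<in> W" "g \<in> C_inf A W" "\<forall>q\<in>W. f q = g q"
      using assms by blast
    have "Ck_on k (\<phi> ` (U \<inter> W)) (g \<circ> inv_into U \<phi>)"
      using W(3) c by (auto simp: C_inf_def smooth_on_def)
    then show "\<exists>T g. open T \<and> x \<in> T \<and> Ck_on k T g \<and> (\<forall>y\<in>T. (f \<circ> inv_into U \<phi>) y = g y)"
      using chart_image_open[OF charts[OF c] W(1)] p W chart_inv[OF charts[OF c]]
      by (intro exI[of _ "\<phi> ` (U \<inter> W)"] exI[of _ "g \<circ> inv_into U \<phi>"]) auto
  qed
  then show ?thesis
    by (auto simp: C_inf_def smooth_on_def)
qed

lemma C_inf_const: "(\<lambda>q. c) \<in> C_inf A V"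
  by (auto simp: C_inf_def smooth_on_def comp_def Ck_on_const)

lemma C_inf_mult:
  assumes "open V" "f \<in> C_inf A V" "g \<in> C_inf A V"
  shows "(\<lambda>q. f q * g q) \<in> C_inf A V"
  using assms chart_image_open[OF charts]
  by (fastforce simp: C_inf_def smooth_on_def comp_def intro: Ck_on_mult)

lemma C_inf_add:
  assumes "open V" "f \<in> C_inf A V" "g \<in> C_inf A V"
  shows "(\<lambda>q. f q + g q) \<in> C_inf A V"
  using assms chart_image_open[OF charts]
  by (fastforce simp: C_inf_def smooth_on_def comp_def intro: Ck_on_add)

lemma C_inf_diff:
  assumes "open V" "f \<in> C_inf A V" "g \<in> C_inf A V"
  shows "(\<lambda>q. f q - g q) \<in> C_inf A V"
  using C_inf_add[OF assms(1,2) C_inf_mult[OF assms(1) C_inf_const[of "-1"] assms(3)]] by simp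

lemma C_inf_continuous_on:
  assumes "f \<in> C_inf A V" "open V"
  shows "continuous_on V f"
proof -
  have "isCont f p" if p: "p \<in> V" for p
  proof -
    obtain U \<phi> where c: "(U, \<phi>) \<in> A" "p \<in> U"
      using mfd unfolding smooth_manifold_def by blast
    have "Ck_on 0 (\<phi> ` (U \<inter> V)) (f \<circ> inv_into U \<phi>)"
      using assms c by (auto simp: C_inf_def smooth_on_def simp del: Ck_on.simps)
    then have f: "continuous_on (\<phi> ` (U \<inter> V)) (f \<circ> inv_into U \<phi>)"
      by (simp only: Ck_on.simps)
    have \<phi>: "continuous_on (U \<inter> V) \<phi>" and U: "open U"
      using charts[OF c(1)] by (auto simp: is_chart_def homeomorphism_def intro: continuous_on_subset)
    \<comment> \<open>On \<open>U \<inter> V\<close> this composite is \<open>f\<close>: continuity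
      is read in the chart and pulled back along it.\<close>
    have "continuous_on (U \<inter> V) ((f \<circ> inv_into U \<phi>) \<circ> \<phi>)"
      by (rule continuous_on_compose[OF \<phi> f])
    then have "continuous_on (U \<inter> V) f"
      by (rule continuous_on_cong[THEN iffD1, rotated -1])
        (use chart_inv[OF charts[OF c(1)]] in auto)
    then show ?thesis
      using c(2) p U assms(2) continuous_on_eq_continuous_at[of "U \<inter> V"] by blast
  qed
  then show ?thesis
    by (simp add: continuous_at_imp_continuous_on)
qed

lemma smooth_near_mult:
  assumes "smooth_near A p f" "smooth_near A p g"
  shows "smooth_near A p (\<lambda>q. f q * g q)"
proof -
  obtain V W where V: "open V" "p \<in> V" "f \<in> C_inf A V" "open W" "p \<in> W" "g \<in> C_inf A W"
    using assms unfolding smooth_near_def by blast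
  then have "(\<lambda>q. f q * g q) \<in> C_inf A (V \<inter> W)"
    by (intro C_inf_mult) (auto elim: C_inf_subset)
  with V show ?thesis
    unfolding smooth_near_def by blast
qed

lemma smooth_near_diff:
  assumes "smooth_near A p f" "smooth_near A p g"
  shows "smooth_near A p (\<lambda>q. f q - g q)"
proof -
  obtain V W where V: "open V" "p \<in> V" "f \<in> C_inf A V" "open W" "p \<in> W" "g \<in> C_inf A W"
    using assms unfolding smooth_near_def by blast
  then have "(\<lambda>q. f q - g q) \<in> C_inf A (V \<inter> W)"
    by (intro C_inf_diff) (auto elim: C_inf_subset)
  with V show ?thesis
    unfolding smooth_near_def by blast
qed

lemma tangent_diff:
  assumes "v \<in> tangent_space A p" "smooth_near A p f" "smooth_near A p g"
  shows "v (\<lambda>q. f q - g q) = v f - v g"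
proof -
  have "smooth_near A p (\<lambda>q. (- 1) * g q)"
    by (rule smooth_near_mult[OF _ assms(3)])
      (auto simp: smooth_near_def intro: C_inf_const)
  then have "v (\<lambda>q. f q + (- 1) * g q) = v f + v (\<lambda>q. (- 1) * g q)"
    using assms(1,2) unfolding tangent_space_def by blast
  then show ?thesis
    using tangent_scale[OF assms(1,3), of "- 1"] by simp
qed

section \<open>The Schouten bracket of a decomposable bivector field\<close>

text \<open>Locality of \<open>v\<close> replaces \<open>P\<close> by the wedge product, known only
  on \<open>U\<close>; the Leibniz rule then differentiates its two products.\<close>

lemma tangent_wedge2:
  assumes v: "v \<in> tangent_space A p"
    and X: "X \<in> vector_fields A U" and Y: "Y \<in> vector_fields A U" and U: "open U" "p \<in> U"
    and P: "\<And>q. q \<in> U \<Longrightarrow> P q = wedge2 (Y q) (X q)"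
    and g: "smooth_near A p g" and k: "smooth_near A p k"
  shows "v (\<lambda>q. P q g k) =
    Y p g * v (\<lambda>q. X q k) + v (\<lambda>q. Y q g) * X p k
      - (X p g * v (\<lambda>q. Y q k) + v (\<lambda>q. X q g) * Y p k)"
proof -
  note sX = smooth_near_vector_field[OF X U] and sY = smooth_near_vector_field[OF Y U]
  have s: "smooth_near A p (\<lambda>q. Y q g * X q k)" "smooth_near A p (\<lambda>q. X q g * Y q k)"
    by (intro smooth_near_mult sX sY g k)+
  have "\<forall>\<^sub>F q in nhds p. Y q g * X q k - X q g * Y q k = P q g k"
    using eventually_nhds_in_open[OF U] by eventually_elim (simp add: P wedge2_def)
  then have "v (\<lambda>q. P q g k) = v (\<lambda>q. Y q g * X q k - X q g * Y q k)"
    by (rule tangent_local[OF v smooth_near_diff[OF s], symmetric])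
  also have "\<dots> = Y p g * v (\<lambda>q. X q k) + v (\<lambda>q. Y q g) * X p k
      - (X p g * v (\<lambda>q. Y q k) + v (\<lambda>q. X q g) * Y p k)"
    by (simp add: tangent_diff[OF v s] tangent_mult[OF v sY[OF g] sX[OF k]]
        tangent_mult[OF v sX[OF g] sY[OF k]])
  finally show ?thesis .
qed

text \<open>In the cyclic sum the terms with \<open>X\<close> or \<open>Y\<close> applied twice
  cancel, and the mixed second derivatives combine into commutators, which are the values of
  \<open>[X,Y]\<close>. The factor 2 comes from the two equal halves of \<open>schouten\<close> when
  both arguments are \<open>P\<close>.\<close>

lemma schouten_wedge2:
  assumes X: "X \<in> vector_fields A U" and Y: "Y \<in> vector_fields A U" and U: "open U" "p \<in> U"
    and P: "\<And>q. q \<in> U \<Longrightarrow> P q = wedge2 (Y q) (X q)"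
  shows "schouten A P P p =
    (\<lambda>f g k. 2 * wedge3 (lie_bracket A X Y p) (X p) (Y p) f g k)"
proof (intro ext)
  fix f g k
  have tX: "X p \<in> tangent_space A p" and tY: "Y p \<in> tangent_space A p"
    using X Y U unfolding vector_fields_def by auto
  show "schouten A P P p f g k = 2 * wedge3 (lie_bracket A X Y p) (X p) (Y p) f g k"
  proof (cases "smooth_near A p f \<and> smooth_near A p g \<and> smooth_near A p k")
    case True
    have e: "P p a (\<lambda>q. P q b c) =
       Y p a * (Y p b * X p (\<lambda>q. X q c) + X p (\<lambda>q. Y q b) * X p c
         - (X p b * X p (\<lambda>q. Y q c) + X p (\<lambda>q. X q b) * Y p c))
       - X p a * (Y p b * Y p (\<lambda>q. X q c) + Y p (\<lambda>q. Y q b) * X p c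
         - (X p b * Y p (\<lambda>q. Y q c) + Y p (\<lambda>q. X q b) * Y p c))"
      if "smooth_near A p b" "smooth_near A p c" for a b c
      using tangent_wedge2[OF tX X Y U P that] tangent_wedge2[OF tY X Y U P that]
      by (simp add: P[OF U(2)] wedge2_def)
    show ?thesis
      using True by (simp add: schouten_def e wedge3_def lie_bracket_def) algebra
  next
    \<comment> \<open>Both sides vanish by convention: \<open>schouten\<close> by its default, and
      \<open>wedge3\<close> because every term contains each of \<open>f\<close>, \<open>g\<close>,
      \<open>k\<close> once and all three vectors send a non-smooth function to 0.\<close>
    case False
    then have "schouten A P P p f g k = 0"
      by (auto simp: schouten_def)
    moreover have "wedge3 (lie_bracket A X Y p) (X p) (Y p) f g k = 0"
      using False tangent_not_smooth[OF tX] tangent_not_smooth[OF tY]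
      by (auto simp: wedge3_def lie_bracket_def)
    ultimately show ?thesis by simp
  qed
qed

section \<open>Poisson structures and normal classes\<close>

lemma poisson_wedge2_iff:
  assumes X: "X \<in> vector_fields A UNIV" and Y: "Y \<in> vector_fields A UNIV"
  shows "poisson A (\<lambda>p. wedge2 (Y p) (X p)) \<longleftrightarrow>
    (\<forall>p. wedge3 (lie_bracket A X Y p) (X p) (Y p) = (\<lambda>f g k. 0))"
proof -
  have "wedge2 (Y p) (X p) \<in> bivectors A p" for p
    unfolding bivectors_def
    by (rule CollectI, rule exI[of _ "1::nat"], rule exI[of _ "\<lambda>_. Y p"], rule exI[of _ "\<lambda>_. X p"])
      (use X Y in \<open>auto simp: vector_fields_def\<close>)
  moreover have "(\<lambda>p. wedge2 (Y p) (X p) f g) \<in> C_inf A V"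
    if "open V" "f \<in> C_inf A V" "g \<in> C_inf A V" for V f g
    using X Y that unfolding wedge2_def vector_fields_def
    by (intro C_inf_diff C_inf_mult) auto
  ultimately have "(\<lambda>p. wedge2 (Y p) (X p)) \<in> bivector_fields A"
    by (simp add: bivector_fields_def)
  then show ?thesis
    unfolding poisson_def
    by (simp add: schouten_wedge2[OF X Y] fun_eq_iff)
qed

text \<open>The equality set of two continuous functions is closed, so it contains the closure of
  \<open>{p. X p \<noteq> (\<lambda>f. 0)}\<close> as soon as it contains that set. This provides
  both the normalization of \<open>Y0\<close> and the regularity of \<open>h\<close>.\<close>

lemma normalized_on_supp:
  assumes Y: "Y \<in> vector_fields A UNIV" and h: "h \<in> C_inf A UNIV"
    and n: "\<And>p. (\<lambda>f. Y p h * X p f) = X p" and p: "p \<in> supp X"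
  shows "Y p h = 1"
proof -
  have "continuous_on UNIV (\<lambda>p. Y p h)"
    using Y h unfolding vector_fields_def by (auto intro!: C_inf_continuous_on)
  then have "closed {p. Y p h = 1}"
    by (intro closed_Collect_eq continuous_on_const)
  moreover have "{p. X p \<noteq> (\<lambda>f. 0)} \<subseteq> {p. Y p h = 1}"
  proof clarify
    fix p assume "X p \<noteq> (\<lambda>f. 0)"
    then obtain f where "X p f \<noteq> 0" by auto
    then show "Y p h = 1"
      using fun_cong[OF n[of p], of f] by simp
  qed
  ultimately show ?thesis
    using p closure_minimal unfolding supp_def by blast
qed

lemma transversal_of_class:
  assumes X: "X \<in> vector_fields A UNIV" and Y: "Y \<in> vector_fields A UNIV"
    and h: "first_integral A X h"
    and n: "\<And>p. (\<lambda>f. Y p h * X p f) = X p"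
    and inv: "\<And>p. wedge3 (lie_bracket A X Y p) (X p) (Y p) = (\<lambda>f g k. 0)"
  shows "transversal_near_supp A X h UNIV Y"
proof -
  have hC: "h \<in> C_inf A UNIV" and Xh: "X q h = 0" for q
    using h unfolding first_integral_def by auto
  have sh: "smooth_near A p h" for p
    using hC unfolding smooth_near_def by blast
  have "wedge2 (lie_bracket A X Y p) (X p) f g = 0" for p f g
  proof (cases "X p = (\<lambda>f. 0)")
    case False
    have tX: "X p \<in> tangent_space A p" and tY: "Y p \<in> tangent_space A p"
      using X Y unfolding vector_fields_def by auto
    \<comment> \<open>\<open>a\<close> is a test function along which \<open>X p\<close> can be
      cancelled; it is smooth near \<open>p\<close> because tangent vectors kill all other
      functions.\<close>
    obtain a where a: "X p a \<noteq> 0" using False by auto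
    then have sa: "smooth_near A p a"
      using tangent_not_smooth[OF tX] by blast
    note sX = smooth_near_vector_field[OF X open_UNIV UNIV_I]
    note sY = smooth_near_vector_field[OF Y open_UNIV UNIV_I]
    have Yh: "Y p h = 1"
      using fun_cong[OF n[of p], of a] a by simp
    \<comment> \<open>The normalization holds at every \<open>q\<close>, so it may be differentiated
      along \<open>X\<close>. As \<open>Y p h = 1\<close>, Leibniz leaves
      \<open>X p (\<lambda>q. Y q h) * X p a = 0\<close>.\<close>
    have "Y q h * X q a = X q a" for q
      using fun_cong[OF n[of q], of a] .
    then have "X p (\<lambda>q. X q a) = X p (\<lambda>q. Y q h * X q a)"
      by presburger
    also have "\<dots> = Y p h * X p (\<lambda>q. X q a) + X p (\<lambda>q. Y q h) * X p a"
      by (rule tangent_mult[OF tX sY[OF sh] sX[OF sa]])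
    finally have "X p (\<lambda>q. Y q h) * X p a = 0"
      using Yh by simp
    \<comment> \<open>The function \<open>\<lambda>q. X q h\<close> is zero, written as
      \<open>0 * h\<close> in order to apply homogeneity.\<close>
    moreover have "Y p (\<lambda>q. X q h) = 0"
      using tangent_scale[OF tY sh, of 0] by (simp add: Xh)
    ultimately have "lie_bracket A X Y p h = 0"
      using a by (simp add: lie_bracket_def)
    \<comment> \<open>With \<open>h\<close> in the last slot, \<open>[X,Y]\<close> and
      \<open>X\<close> contribute 0 and \<open>Y\<close> contributes 1, so the determinant reduces
      to the minor of \<open>[X,Y]\<close> and \<open>X\<close> at \<open>f\<close>,
      \<open>g\<close>.\<close>
    moreover have "wedge3 (lie_bracket A X Y p) (X p) (Y p) f g h = 0"
      by (simp add: inv)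
    ultimately show ?thesis
      using Yh Xh[of p] by (simp add: wedge3_def wedge2_def algebra_simps)
  qed (simp add: wedge2_def)
  then have "\<forall>p\<in>UNIV. wedge2 (lie_bracket A X Y p) (X p) = (\<lambda>f g. 0)"
    by (intro ballI ext)
  moreover have "\<forall>p\<in>supp X. Y p h = 1"
    using normalized_on_supp[OF Y hC n] by blast
  ultimately show ?thesis
    using Y unfolding transversal_near_supp_def by simp
qed

section \<open>The glued bivector is a Poisson structure\<close>

text \<open>Two open sets suffice for smoothness: \<open>U\<close>, where the wedge formula has
  smooth ingredients, and the complement of the closed set \<open>supp X\<close>, where the bivector
  is 0.\<close>

lemma glued_bivector_field:
  assumes X: "X \<in> vector_fields A UNIV" and t: "transversal_near_supp A X h U Y0"
  shows "glued_bivector X Y0 \<in> bivector_fields A"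
proof -
  have U: "open U" "supp X \<subseteq> U" and Y0: "Y0 \<in> vector_fields A U"
    using t unfolding transversal_near_supp_def by auto
  have "glued_bivector X Y0 p \<in> bivectors A p" for p
  proof (cases "p \<in> supp X")
    case True
    then have "X p \<in> tangent_space A p" "Y0 p \<in> tangent_space A p"
      using X Y0 U unfolding vector_fields_def by auto
    with True show ?thesis
      unfolding bivectors_def glued_bivector_def
      by (intro CollectI exI[of _ "1::nat"] exI[of _ "\<lambda>_. Y0 p"] exI[of _ "\<lambda>_. X p"]) auto
  next
    case False
    then show ?thesis
      unfolding bivectors_def glued_bivector_def
      \<comment> \<open>The zero bivector is the empty sum.\<close>
      by (intro CollectI exI[of _ "0::nat"]) auto
  qed
  moreover have "(\<lambda>p. glued_bivector X Y0 p f g) \<in> C_inf A V"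
    if V: "open V" "f \<in> C_inf A V" "g \<in> C_inf A V" for V f g
  proof (rule C_inf_locally)
    fix p assume p: "p \<in> V"
    show "\<exists>W k. open W \<and> p \<in> W \<and> k \<in> C_inf A W \<and> (\<forall>q\<in>W. glued_bivector X Y0 q f g = k q)"
    proof (cases "p \<in> supp X")
      case True
      have o: "open (V \<inter> U)"
        using V(1) U(1) by blast
      have fg: "f \<in> C_inf A (V \<inter> U)" "g \<in> C_inf A (V \<inter> U)"
        using V by (auto elim: C_inf_subset)
      have "(\<lambda>q. wedge2 (Y0 q) (X q) f g) \<in> C_inf A (V \<inter> U)"
        using X Y0 o fg unfolding wedge2_def vector_fields_def
        by (intro C_inf_diff C_inf_mult o) auto
      with o p True U(2) show ?thesis
        by (intro exI[of _ "V \<inter> U"] exI[of _ "\<lambda>q. wedge2 (Y0 q) (X q) f g"])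
          (auto simp: glued_bivector_eq)
    next
      case False
      have "open (- supp X)"
        by (simp add: supp_def open_Compl)
      with False show ?thesis
        by (intro exI[of _ "- supp X"] exI[of _ "\<lambda>q. 0"])
          (auto simp: glued_bivector_def C_inf_const)
    qed
  qed
  ultimately show ?thesis
    by (simp add: bivector_fields_def)
qed

lemma poisson_glued_bivector:
  assumes X: "X \<in> vector_fields A UNIV" and t: "transversal_near_supp A X h U Y0"
  shows "poisson A (glued_bivector X Y0)"
proof -
  have U: "open U" "supp X \<subseteq> U" and Y0: "Y0 \<in> vector_fields A U"
    and L: "\<And>p. p \<in> U \<Longrightarrow> wedge2 (lie_bracket A X Y0 p) (X p) = (\<lambda>f g. 0)"
    using t unfolding transversal_near_supp_def by auto
  have XU: "X \<in> vector_fields A U"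
    using X unfolding vector_fields_def by auto
  have "schouten A (glued_bivector X Y0) (glued_bivector X Y0) p f g k = 0" for p f g k
  proof (cases "p \<in> supp X")
    case True
    then have p: "p \<in> U" using U by blast
    \<comment> \<open>These are the vanishing minors of \<open>[X,Y0]\<close> and \<open>X\<close>;
      expanding the determinant along \<open>Y0\<close> involves only them.\<close>
    have L0: "lie_bracket A X Y0 p a * X p b = X p a * lie_bracket A X Y0 p b" for a b
      using fun_cong[OF fun_cong[OF L[OF p], of a], of b] by (simp add: wedge2_def)
    have "wedge3 (lie_bracket A X Y0 p) (X p) (Y0 p) f g k = 0"
      unfolding wedge3_def using L0[of f g] L0[of g k] L0[of k f] by algebra
    then show ?thesis
      using schouten_wedge2[OF XU Y0 U(1) p, of "glued_bivector X Y0"]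
      by (simp add: glued_bivector_eq)
  \<comment> \<open>Off \<open>supp X\<close> every term of \<open>schouten\<close> has the outer
    bivector evaluated at \<open>p\<close>, where it is 0.\<close>
  qed (simp add: schouten_def glued_bivector_def)
  then show ?thesis
    using glued_bivector_field[OF X t] by (simp add: poisson_def fun_eq_iff)
qed

section \<open>The equivalence\<close>

text \<open>The class of \<open>Y\<close> works: being Poisson and generating \<open>X\<close> from
  \<open>h\<close> are statements about \<open>Y \<and> X\<close> alone, so they pass to every
  representative.\<close>

lemma hamiltonizable_imp_class:
  assumes X: "X \<in> vector_fields A UNIV" and "wedge_hamiltonizable A X"
  shows "\<exists>C\<in>normal_classes A X. \<exists>h. invariant_class A X C \<and> first_integral A X h \<and>
    regular_on A h (supp X) \<and> normalized_class X h C"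
proof -
  obtain Y h where Y: "Y \<in> vector_fields A UNIV" and h: "h \<in> C_inf A UNIV"
    and P: "poisson A (\<lambda>p. wedge2 (Y p) (X p))"
    and s: "sharp_d (\<lambda>p. wedge2 (Y p) (X p)) h = X"
    using assms(2) unfolding wedge_hamiltonizable_def by blast
  have Xh: "\<forall>p. X p h = 0" and n: "\<And>p. (\<lambda>f. Y p h * X p f) = X p"
    using s unfolding sharp_wedge2_iff by auto
  let ?C = "normal_rel A X `` {Y}"
  have C: "?C \<in> normal_classes A X"
    using Y unfolding normal_classes_def by (rule quotientI)
  have Y': "Y' \<in> vector_fields A UNIV \<and>
      (\<lambda>p. wedge2 (Y' p) (X p)) = (\<lambda>p. wedge2 (Y p) (X p))" if "Y' \<in> ?C" for Y'
    using that normal_rel_wedge2_eq[of Y Y' A X] by (auto simp: normal_rel_def)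
  have "poisson A (\<lambda>p. wedge2 (Y' p) (X p))" if "Y' \<in> ?C" for Y'
    using P Y'[OF that] by (simp only:)
  then have "\<forall>p. wedge3 (lie_bracket A X Y' p) (X p) (Y' p) = (\<lambda>f g k. 0)" if "Y' \<in> ?C" for Y'
    using that Y' poisson_wedge2_iff[OF X] by blast
  then have "invariant_class A X ?C"
    unfolding invariant_class_def by blast
  moreover have "normalized_class X h ?C"
    unfolding normalized_class_def
  proof
    fix Y' assume "Y' \<in> ?C"
    then have "sharp_d (\<lambda>p. wedge2 (Y' p) (X p)) h = X"
      using s Y'[of Y'] by (simp only:)
    then show "\<forall>p. (\<lambda>f. Y' p h * X p f) = X p"
      unfolding sharp_wedge2_iff by blast
  qed
  moreover have "regular_on A h (supp X)"
    unfolding regular_on_def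
  proof
    fix p assume "p \<in> supp X"
    then have "Y p h = 1"
      by (rule normalized_on_supp[OF Y h n])
    then show "\<exists>v\<in>tangent_space A p. v h \<noteq> 0"
      \<comment> \<open>The vector \<open>Y p\<close> itself detects \<open>dh\<close>, since
        \<open>dh(Y) = 1\<close> on the support.\<close>
      using Y by (intro bexI[of _ "Y p"]) (auto simp: vector_fields_def)
  qed
  ultimately show ?thesis
    using C Xh h unfolding first_integral_def by blast
qed

lemma class_imp_hamiltonizable:
  assumes X: "X \<in> vector_fields A UNIV" and C: "C \<in> normal_classes A X"
    and "invariant_class A X C" "first_integral A X h" "normalized_class X h C"
  shows "wedge_hamiltonizable A X"
proof -
  obtain Y where Y: "Y \<in> C" "Y \<in> vector_fields A UNIV"
    using normal_class_rep[OF C] .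
  have "poisson A (\<lambda>p. wedge2 (Y p) (X p))"
    using assms(3) Y by (simp add: poisson_wedge2_iff[OF X] invariant_class_def)
  moreover have "sharp_d (\<lambda>p. wedge2 (Y p) (X p)) h = X"
    using assms(4,5) Y(1) unfolding sharp_wedge2_iff first_integral_def normalized_class_def
    by blast
  ultimately show ?thesis
    using Y(2) assms(4) unfolding wedge_hamiltonizable_def first_integral_def by blast
qed

end

text \<open>The last clause guards against vacuity: when \<open>h\<close> normalizes some invariant
  class, a field \<open>Y0\<close> as required by the gluing formula exists.\<close>

theorem theorem4p2:
  fixes A :: "('m::{t2_space,second_countable_topology}, 'e::real_normed_vector) chart set"
    and X :: "'m vfield"
  assumes "smooth_manifold A"
    and "X \<in> vector_fields A UNIV"
  shows "(wedge_hamiltonizable A X \<longleftrightarrow>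
      (\<exists>C\<in>normal_classes A X. \<exists>h. invariant_class A X C \<and> first_integral A X h \<and>
         regular_on A h (supp X) \<and> normalized_class X h C)) \<and>
    (wedge_hamiltonizable A X \<longrightarrow>
      (\<forall>h. first_integral A X h \<longrightarrow> regular_on A h (supp X) \<longrightarrow>
         (\<forall>U Y0. transversal_near_supp A X h U Y0 \<longrightarrow>
            poisson A (glued_bivector X Y0) \<and> sharp_d (glued_bivector X Y0) h = X) \<and>
         ((\<exists>C\<in>normal_classes A X. invariant_class A X C \<and> normalized_class X h C) \<longrightarrow>
            (\<exists>U Y0. transversal_near_supp A X h U Y0))))"
proof -
  have "\<exists>U Y0. transversal_near_supp A X h U Y0"
    if h: "first_integral A X h" and C: "C \<in> normal_classes A X"
      and i: "invariant_class A X C" and n: "normalized_class X h C" for h C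
  proof -
    obtain Y where Y: "Y \<in> C" "Y \<in> vector_fields A UNIV"
      using normal_class_rep[OF C] .
    then have "transversal_near_supp A X h UNIV Y"
      using i n unfolding invariant_class_def normalized_class_def
      by (intro transversal_of_class[OF assms Y(2) h]) blast+
    then show ?thesis by blast
  qed
  then show ?thesis
    using hamiltonizable_imp_class[OF assms] class_imp_hamiltonizable[OF assms]
      poisson_glued_bivector[OF assms] sharp_glued_bivector
    by blast
qed

end
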